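(* The functors $K\colon \mathbf{Stone}\to\mathbf{SKANc}$ and $C\colon \mathbf{SKANc}\to\mathbf{Stone}$ establish a categorical equivalence between $\mathbf{Stone}$ and $\mathbf{SKANc}$ with natural isomorphisms $\alpha$ and $\beta$, where for a Stone algebra $A$ the component $\alpha\colon A\to C(K(A))$ is $\alpha(x)=(x,0)$, and for a centered Stone KAN-algebra $T$ with center $c$ the component $\beta\colon T\to K(C(T))$ is $\beta(x)=(x\vee c,\ \sim x\vee c)$.
   Context: A distributive p-algebra is an algebra $\langle A,\vee,\wedge,{}^{\ast},0,1\rangle$ whose reduct $\langle A,\vee,\wedge,0,1\rangle$ is a bounded distributive lattice and such that $a\wedge b=0$ iff $a\le b^{\ast}$ for all $a,b\in A$. A Stone algebra is a distributive p-algebra satisfying $x^{\ast}\vee x^{\ast\ast}=1$. $\mathbf{Stone}$ is the category of Stone algebras with algebra homomorphisms. A Kleene algebra is an algebra $\langle T,\vee,\wedge,\sim,0,1\rangle$ whose reduct $\langle T,\vee,\wedge,0,1\rangle$ is a bounded distributive lattice and such that $\sim\sim x=x$, $\sim(x\vee y)=\sim x\wedge\sim y$ and $x\wedge\sim x\le y\vee\sim y$ for all $x,y$. A KAN-algebra is an algebra $\langle T,\vee,\wedge,\sim,\neg,0,1\rangle$ of type $(2,2,1,1,0,0)$ whose $\neg$-free reduct is a Kleene algebra and which satisfies: (N1) $\neg(x\wedge\neg(x\wedge y))=\neg(x\wedge\neg y)$; (N2) $\neg(x\vee y)=\neg x\wedge\neg y$; (N3) $x\wedge\sim x=x\wedge\neg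 x$; (N4) $\sim x\le\neg x$; (N5) $\neg(x\wedge y)=\neg((\sim\neg x)\wedge y)$. A centered KAN-algebra (KANc-algebra) is an algebra $\langle T,\vee,\wedge,\sim,\neg,c,0,1\rangle$ where $\langle T,\vee,\wedge,\sim,\neg,0,1\rangle$ is a KAN-algebra and the constant $c$ (the center) satisfies $\sim c=c$. A centered Stone KAN-algebra is a centered KAN-algebra satisfying $\neg x\vee\neg\neg x=1$ for all $x$. $\mathbf{SKANc}$ is the category of centered Stone KAN-algebras with algebra homomorphisms. The functor $K$: for a Stone algebra $A$, $K(A)=\{(x,y)\in A\times A: x\wedge y=0\}$ with operations $(a,b)\vee(d,e)=(a\vee d,b\wedge e)$, $(a,b)\wedge(d,e)=(a\wedge d,b\vee e)$, $\sim(a,b)=(b,a)$, $\neg(a,b)=(a^{\ast},a)$, bottom $(0,1)$, top $(1,0)$, center $(0,0)$; for a homomorphism $h\colon A\to B$, $K(h)(x,y)=(h(x),h(y))$. The functor $C$: for $T\in\mathbf{SKANc}$ with center $c$, $C(T)=\{x\in T: x\ge c\}$, regarded as the Stone algebra $\langle C(T),\vee,\wedge,\neg^{c},c,1\rangle$ with $\neg^{c}x=\neg x\vee c$; for a homomorphism $f\colon T\to S$, $C(f)\colon C(T)\to C(S)$ is $C(f)(x)=f(x)$. *)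

theory Defs
  imports "HOL-Library.FuncSet" "HOL-Algebra.Congruence"
begin

section \<open>Categories, functors and equivalences\<close>

record ('o, 'm) precategory =
  Ob :: "'o set"
  Arr :: "'m set"
  Dom :: "'m \<Rightarrow> 'o"
  Cod :: "'m \<Rightarrow> 'o"
  Id :: "'o \<Rightarrow> 'm"
  Comp :: "'m \<Rightarrow> 'm \<Rightarrow> 'm"  (infixl "\<odot>\<index>" 70)

locale category =
  fixes C :: "('o, 'm) precategory" (structure)
  assumes Dom_Ob: "f \<in> Arr C \<Longrightarrow> Dom C f \<in> Ob C"
    and Cod_Ob: "f \<in> Arr C \<Longrightarrow> Cod C f \<in> Ob C"
    and Id_Arr: "a \<in> Ob C \<Longrightarrow> Id C a \<in> Arr C"
    and Dom_Id: "a \<in> Ob C \<Longrightarrow> Dom C (Id C a) = a"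
    and Cod_Id: "a \<in> Ob C \<Longrightarrow> Cod C (Id C a) = a"
    and Comp_Arr: "\<lbrakk>f \<in> Arr C; g \<in> Arr C; Cod C f = Dom C g\<rbrakk> \<Longrightarrow> g \<odot> f \<in> Arr C"
    and Dom_Comp: "\<lbrakk>f \<in> Arr C; g \<in> Arr C; Cod C f = Dom C g\<rbrakk> \<Longrightarrow> Dom C (g \<odot> f) = Dom C f"
    and Cod_Comp: "\<lbrakk>f \<in> Arr C; g \<in> Arr C; Cod C f = Dom C g\<rbrakk> \<Longrightarrow> Cod C (g \<odot> f) = Cod C g"
    and Comp_Id_right: "f \<in> Arr C \<Longrightarrow> f \<odot> Id C (Dom C f) = f"
    and Comp_Id_left: "f \<in> Arr C \<Longrightarrow> Id C (Cod C f) \<odot> f = f"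
    and Comp_assoc: "\<lbrakk>f \<in> Arr C; g \<in> Arr C; h \<in> Arr C; Cod C f = Dom C g; Cod C g = Dom C h\<rbrakk>
      \<Longrightarrow> h \<odot> (g \<odot> f) = (h \<odot> g) \<odot> f"

definition isomorphism :: "('o, 'm) precategory \<Rightarrow> 'm \<Rightarrow> bool" where
  "isomorphism C f \<longleftrightarrow> f \<in> Arr C \<and>
     (\<exists>g \<in> Arr C. Dom C g = Cod C f \<and> Cod C g = Dom C f \<and>
        Comp C g f = Id C (Dom C f) \<and> Comp C f g = Id C (Cod C f))"

record ('o, 'm, 'p, 'n) functor_maps =
  on_ob :: "'o \<Rightarrow> 'p"
  on_arr :: "'m \<Rightarrow> 'n"

definition id_functor :: "('o, 'm, 'o, 'm) functor_maps" where
  "id_functor = \<lparr>on_ob = (\<lambda>a. a), on_arr = (\<lambda>f. f)\<rparr>"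

definition comp_functor ::
  "('p, 'n, 'q, 'k) functor_maps \<Rightarrow> ('o, 'm, 'p, 'n) functor_maps \<Rightarrow> ('o, 'm, 'q, 'k) functor_maps" where
  "comp_functor G F = \<lparr>on_ob = (\<lambda>a. on_ob G (on_ob F a)), on_arr = (\<lambda>f. on_arr G (on_arr F f))\<rparr>"

locale covariant_functor = dom: category C + cod: category D
  for C :: "('o, 'm) precategory" and D :: "('p, 'n) precategory" +
  fixes F :: "('o, 'm, 'p, 'n) functor_maps"
  assumes on_ob_Ob: "a \<in> Ob C \<Longrightarrow> on_ob F a \<in> Ob D"
    and on_arr_Arr: "f \<in> Arr C \<Longrightarrow> on_arr F f \<in> Arr D"
    and Dom_on_arr: "f \<in> Arr C \<Longrightarrow> Dom D (on_arr F f) = on_ob F (Dom C f)"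
    and Cod_on_arr: "f \<in> Arr C \<Longrightarrow> Cod D (on_arr F f) = on_ob F (Cod C f)"
    and on_arr_Id: "a \<in> Ob C \<Longrightarrow> on_arr F (Id C a) = Id D (on_ob F a)"
    and on_arr_Comp: "\<lbrakk>f \<in> Arr C; g \<in> Arr C; Cod C f = Dom C g\<rbrakk>
      \<Longrightarrow> on_arr F (Comp C g f) = Comp D (on_arr F g) (on_arr F f)"

locale natural_transformation = F: covariant_functor C D F + G: covariant_functor C D G
  for C :: "('o, 'm) precategory" and D :: "('p, 'n) precategory" and F G +
  fixes \<eta> :: "'o \<Rightarrow> 'n"
  assumes component_Arr: "a \<in> Ob C \<Longrightarrow> \<eta> a \<in> Arr D"
    and Dom_component: "a \<in> Ob C \<Longrightarrow> Dom D (\<eta> a) = on_ob F a"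
    and Cod_component: "a \<in> Ob C \<Longrightarrow> Cod D (\<eta> a) = on_ob G a"
    and naturality: "f \<in> Arr C \<Longrightarrow>
      Comp D (\<eta> (Cod C f)) (on_arr F f) = Comp D (on_arr G f) (\<eta> (Dom C f))"

locale natural_isomorphism = natural_transformation +
  assumes component_iso: "a \<in> Ob C \<Longrightarrow> isomorphism D (\<eta> a)"

locale categorical_equivalence =
  F: covariant_functor C D F + G: covariant_functor D C G +
  GF: natural_isomorphism C C id_functor "comp_functor G F" \<eta> +
  FG: natural_isomorphism D D id_functor "comp_functor F G" \<epsilon>
  for C :: "('o, 'm) precategory" and D :: "('p, 'n) precategory" and F G \<eta> \<epsilon>


section \<open>Stone algebras\<close>

text \<open>
  Algebras are carrier-based: the laws are required on the carrier only, and the values of the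
  operations outside the carrier are irrelevant.
\<close>

record 'a bdl_struct = "'a partial_object" +
  join :: "'a \<Rightarrow> 'a \<Rightarrow> 'a"  (infixl "\<squnion>\<index>" 65)
  meet :: "'a \<Rightarrow> 'a \<Rightarrow> 'a"  (infixl "\<sqinter>\<index>" 70)
  bzero :: "'a"  ("\<zero>\<index>")
  bone :: "'a"  ("\<one>\<index>")

definition leq :: "('a, 'b) bdl_struct_scheme \<Rightarrow> 'a \<Rightarrow> 'a \<Rightarrow> bool"  (infix "\<sqsubseteq>\<index>" 50) where
  "x \<sqsubseteq>\<^bsub>L\<^esub> y \<longleftrightarrow> x \<sqinter>\<^bsub>L\<^esub> y = x"

locale bounded_distributive_lattice =
  fixes L :: "('a, 'b) bdl_struct_scheme" (structure)
  assumes join_closed: "\<lbrakk>x \<in> carrier L; y \<in> carrier L\<rbrakk> \<Longrightarrow> x \<squnion> y \<in> carrier L"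
    and meet_closed: "\<lbrakk>x \<in> carrier L; y \<in> carrier L\<rbrakk> \<Longrightarrow> x \<sqinter> y \<in> carrier L"
    and zero_closed: "\<zero> \<in> carrier L"
    and one_closed: "\<one> \<in> carrier L"
    and join_assoc: "\<lbrakk>x \<in> carrier L; y \<in> carrier L; z \<in> carrier L\<rbrakk>
      \<Longrightarrow> (x \<squnion> y) \<squnion> z = x \<squnion> (y \<squnion> z)"
    and meet_assoc: "\<lbrakk>x \<in> carrier L; y \<in> carrier L; z \<in> carrier L\<rbrakk>
      \<Longrightarrow> (x \<sqinter> y) \<sqinter> z = x \<sqinter> (y \<sqinter> z)"
    and join_comm: "\<lbrakk>x \<in> carrier L; y \<in> carrier L\<rbrakk> \<Longrightarrow> x \<squnion> y = y \<squnion> x"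
    and meet_comm: "\<lbrakk>x \<in> carrier L; y \<in> carrier L\<rbrakk> \<Longrightarrow> x \<sqinter> y = y \<sqinter> x"
    and join_meet_absorb: "\<lbrakk>x \<in> carrier L; y \<in> carrier L\<rbrakk> \<Longrightarrow> x \<squnion> (x \<sqinter> y) = x"
    and meet_join_absorb: "\<lbrakk>x \<in> carrier L; y \<in> carrier L\<rbrakk> \<Longrightarrow> x \<sqinter> (x \<squnion> y) = x"
    and meet_join_distrib: "\<lbrakk>x \<in> carrier L; y \<in> carrier L; z \<in> carrier L\<rbrakk>
      \<Longrightarrow> x \<sqinter> (y \<squnion> z) = (x \<sqinter> y) \<squnion> (x \<sqinter> z)"
    and zero_least: "x \<in> carrier L \<Longrightarrow> \<zero> \<sqsubseteq> x"
    and one_greatest: "x \<in> carrier L \<Longrightarrow> x \<sqsubseteq> \<one>"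

record 'a p_struct = "'a bdl_struct" +
  pcomp :: "'a \<Rightarrow> 'a"  ("\<star>\<index> _" [81] 80)

locale distributive_p_algebra = bounded_distributive_lattice A
  for A :: "('a, 'b) p_struct_scheme" (structure) +
  assumes pcomp_closed: "x \<in> carrier A \<Longrightarrow> \<star> x \<in> carrier A"
    and pcomp_iff: "\<lbrakk>x \<in> carrier A; y \<in> carrier A\<rbrakk> \<Longrightarrow> x \<sqinter> y = \<zero> \<longleftrightarrow> x \<sqsubseteq> \<star> y"

locale stone_algebra = distributive_p_algebra A
  for A :: "('a, 'b) p_struct_scheme" (structure) +
  assumes stone: "x \<in> carrier A \<Longrightarrow> \<star> x \<squnion> \<star> (\<star> x) = \<one>"

definition bdl_hom ::
  "('a, 'c) bdl_struct_scheme \<Rightarrow> ('b, 'd) bdl_struct_scheme \<Rightarrow> ('a \<Rightarrow> 'b) set" where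
  "bdl_hom L M = {h \<in> carrier L \<rightarrow>\<^sub>E carrier M.
     (\<forall>x \<in> carrier L. \<forall>y \<in> carrier L. h (x \<squnion>\<^bsub>L\<^esub> y) = h x \<squnion>\<^bsub>M\<^esub> h y) \<and>
     (\<forall>x \<in> carrier L. \<forall>y \<in> carrier L. h (x \<sqinter>\<^bsub>L\<^esub> y) = h x \<sqinter>\<^bsub>M\<^esub> h y) \<and>
     h \<zero>\<^bsub>L\<^esub> = \<zero>\<^bsub>M\<^esub> \<and> h \<one>\<^bsub>L\<^esub> = \<one>\<^bsub>M\<^esub>}"

definition p_hom ::
  "('a, 'c) p_struct_scheme \<Rightarrow> ('b, 'd) p_struct_scheme \<Rightarrow> ('a \<Rightarrow> 'b) set" where
  "p_hom A B = {h \<in> bdl_hom A B. \<forall>x \<in> carrier A. h (\<star>\<^bsub>A\<^esub> x) = \<star>\<^bsub>B\<^esub> (h x)}"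


section \<open>Centered Stone KAN-algebras\<close>

record 'a kleene_struct = "'a bdl_struct" +
  kneg :: "'a \<Rightarrow> 'a"  ("\<sim>\<index> _" [81] 80)

record 'a kan_struct = "'a kleene_struct" +
  ineg :: "'a \<Rightarrow> 'a"  ("\<ominus>\<index> _" [81] 80)

record 'a kanc_struct = "'a kan_struct" +
  center :: "'a"  ("\<cc>\<index>")

locale kleene_algebra = bounded_distributive_lattice T
  for T :: "('a, 'b) kleene_struct_scheme" (structure) +
  assumes kneg_closed: "x \<in> carrier T \<Longrightarrow> \<sim> x \<in> carrier T"
    and kneg_kneg: "x \<in> carrier T \<Longrightarrow> \<sim> (\<sim> x) = x"
    and kneg_join: "\<lbrakk>x \<in> carrier T; y \<in> carrier T\<rbrakk> \<Longrightarrow> \<sim> (x \<squnion> y) = \<sim> x \<sqinter> \<sim> y"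
    and kleene: "\<lbrakk>x \<in> carrier T; y \<in> carrier T\<rbrakk> \<Longrightarrow> x \<sqinter> \<sim> x \<sqsubseteq> y \<squnion> \<sim> y"

locale kan_algebra = kleene_algebra T
  for T :: "('a, 'b) kan_struct_scheme" (structure) +
  assumes ineg_closed: "x \<in> carrier T \<Longrightarrow> \<ominus> x \<in> carrier T"
    and N1: "\<lbrakk>x \<in> carrier T; y \<in> carrier T\<rbrakk> \<Longrightarrow> \<ominus> (x \<sqinter> \<ominus> (x \<sqinter> y)) = \<ominus> (x \<sqinter> \<ominus> y)"
    and N2: "\<lbrakk>x \<in> carrier T; y \<in> carrier T\<rbrakk> \<Longrightarrow> \<ominus> (x \<squnion> y) = \<ominus> x \<sqinter> \<ominus> y"
    and N3: "x \<in> carrier T \<Longrightarrow> x \<sqinter> \<sim> x = x \<sqinter> \<ominus> x"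
    and N4: "x \<in> carrier T \<Longrightarrow> \<sim> x \<sqsubseteq> \<ominus> x"
    and N5: "\<lbrakk>x \<in> carrier T; y \<in> carrier T\<rbrakk> \<Longrightarrow> \<ominus> (x \<sqinter> y) = \<ominus> ((\<sim> (\<ominus> x)) \<sqinter> y)"

locale centered_kan_algebra = kan_algebra T
  for T :: "('a, 'b) kanc_struct_scheme" (structure) +
  assumes center_closed: "\<cc> \<in> carrier T"
    and kneg_center: "\<sim> \<cc> = \<cc>"

locale centered_stone_kan_algebra = centered_kan_algebra T
  for T :: "('a, 'b) kanc_struct_scheme" (structure) +
  assumes stone: "x \<in> carrier T \<Longrightarrow> \<ominus> x \<squnion> \<ominus> (\<ominus> x) = \<one>"

definition kanc_hom ::
  "('a, 'c) kanc_struct_scheme \<Rightarrow> ('b, 'd) kanc_struct_scheme \<Rightarrow> ('a \<Rightarrow> 'b) set" where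
  "kanc_hom T S = {f \<in> bdl_hom T S.
     (\<forall>x \<in> carrier T. f (\<sim>\<^bsub>T\<^esub> x) = \<sim>\<^bsub>S\<^esub> (f x)) \<and>
     (\<forall>x \<in> carrier T. f (\<ominus>\<^bsub>T\<^esub> x) = \<ominus>\<^bsub>S\<^esub> (f x)) \<and>
     f \<cc>\<^bsub>T\<^esub> = \<cc>\<^bsub>S\<^esub>}"


section \<open>The categories of Stone algebras and of centered Stone KAN-algebras\<close>

text \<open>
  An arrow from \<open>A\<close> to \<open>B\<close> is a triple \<open>(A, h, B)\<close>, where \<open>h\<close> is a map between the carriers,
  extended by \<open>undefined\<close> so that arrows are equal iff they agree on the carrier.
\<close>

type_synonym ('x, 'a) arrow = "'x \<times> ('a \<Rightarrow> 'a) \<times> 'x"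

abbreviation arr_dom :: "('x, 'a) arrow \<Rightarrow> 'x" where
  "arr_dom f \<equiv> fst f"

abbreviation arr_map :: "('x, 'a) arrow \<Rightarrow> 'a \<Rightarrow> 'a" where
  "arr_map f \<equiv> fst (snd f)"

abbreviation arr_cod :: "('x, 'a) arrow \<Rightarrow> 'x" where
  "arr_cod f \<equiv> snd (snd f)"

definition concrete_category ::
  "('a, 'b) partial_object_scheme set \<Rightarrow>
   (('a, 'b) partial_object_scheme \<Rightarrow> ('a, 'b) partial_object_scheme \<Rightarrow> ('a \<Rightarrow> 'a) set) \<Rightarrow>
   (('a, 'b) partial_object_scheme, (('a, 'b) partial_object_scheme, 'a) arrow) precategory" where
  "concrete_category X H = \<lparr>
     Ob = X,
     Arr = {(A, h, B). A \<in> X \<and> B \<in> X \<and> h \<in> H A B},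
     Dom = (\<lambda>f. arr_dom f),
     Cod = (\<lambda>f. arr_cod f),
     Id = (\<lambda>A. (A, (\<lambda>x \<in> carrier A. x), A)),
     Comp = (\<lambda>g f. (arr_dom f, compose (carrier (arr_dom f)) (arr_map g) (arr_map f), arr_cod g))\<rparr>"

text \<open>
  A category in HOL has all its objects in one type, whereas \<open>K\<close> turns an algebra over \<open>'a\<close> into
  one over pairs. All algebras are therefore taken with carrier in a universe \<open>'u univ\<close>, which
  contains \<open>'u\<close> and is closed under ordered pairs. As \<open>'u\<close> is arbitrary, every algebra, over
  whatever type, has a copy (via \<open>Atom\<close>) in such a universe.
\<close>

datatype 'u univ = Atom 'u | Pr (pfst: "'u univ") (psnd: "'u univ")  ("\<langle>_,/ _\<rangle>")

type_synonym 'u stone_ob = "'u univ p_struct"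
type_synonym 'u skanc_ob = "'u univ kanc_struct"

definition Stone :: "('u stone_ob, ('u stone_ob, 'u univ) arrow) precategory" where
  "Stone = concrete_category {A. stone_algebra A} p_hom"

definition SKANc :: "('u skanc_ob, ('u skanc_ob, 'u univ) arrow) precategory" where
  "SKANc = concrete_category {T. centered_stone_kan_algebra T} kanc_hom"


section \<open>The functors and the natural isomorphisms\<close>

definition K_ob :: "'u stone_ob \<Rightarrow> 'u skanc_ob" where
  "K_ob A = \<lparr>
     carrier = {\<langle>x, y\<rangle> | x y. x \<in> carrier A \<and> y \<in> carrier A \<and> x \<sqinter>\<^bsub>A\<^esub> y = \<zero>\<^bsub>A\<^esub>},
     join = (\<lambda>p q. \<langle>pfst p \<squnion>\<^bsub>A\<^esub> pfst q, psnd p \<sqinter>\<^bsub>A\<^esub> psnd q\<rangle>),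
     meet = (\<lambda>p q. \<langle>pfst p \<sqinter>\<^bsub>A\<^esub> pfst q, psnd p \<squnion>\<^bsub>A\<^esub> psnd q\<rangle>),
     bzero = \<langle>\<zero>\<^bsub>A\<^esub>, \<one>\<^bsub>A\<^esub>\<rangle>,
     bone = \<langle>\<one>\<^bsub>A\<^esub>, \<zero>\<^bsub>A\<^esub>\<rangle>,
     kneg = (\<lambda>p. \<langle>psnd p, pfst p\<rangle>),
     ineg = (\<lambda>p. \<langle>\<star>\<^bsub>A\<^esub> (pfst p), pfst p\<rangle>),
     center = \<langle>\<zero>\<^bsub>A\<^esub>, \<zero>\<^bsub>A\<^esub>\<rangle>\<rparr>"

definition K_functor ::
  "('u stone_ob, ('u stone_ob, 'u univ) arrow, 'u skanc_ob, ('u skanc_ob, 'u univ) arrow) functor_maps" where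
  "K_functor = \<lparr>
     on_ob = K_ob,
     on_arr = (\<lambda>(A, h, B). (K_ob A, (\<lambda>p \<in> carrier (K_ob A). \<langle>h (pfst p), h (psnd p)\<rangle>), K_ob B))\<rparr>"

definition C_ob :: "'u skanc_ob \<Rightarrow> 'u stone_ob" where
  "C_ob T = \<lparr>
     carrier = {x \<in> carrier T. \<cc>\<^bsub>T\<^esub> \<sqsubseteq>\<^bsub>T\<^esub> x},
     join = join T,
     meet = meet T,
     bzero = \<cc>\<^bsub>T\<^esub>,
     bone = \<one>\<^bsub>T\<^esub>,
     pcomp = (\<lambda>x. \<ominus>\<^bsub>T\<^esub> x \<squnion>\<^bsub>T\<^esub> \<cc>\<^bsub>T\<^esub>)\<rparr>"

definition C_functor ::
  "('u skanc_ob, ('u skanc_ob, 'u univ) arrow, 'u stone_ob, ('u stone_ob, 'u univ) arrow) functor_maps" where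
  "C_functor = \<lparr>
     on_ob = C_ob,
     on_arr = (\<lambda>(T, f, S). (C_ob T, (\<lambda>x \<in> carrier (C_ob T). f x), C_ob S))\<rparr>"

definition alpha :: "'u stone_ob \<Rightarrow> ('u stone_ob, 'u univ) arrow" where
  "alpha A = (A, (\<lambda>x \<in> carrier A. \<langle>x, \<zero>\<^bsub>A\<^esub>\<rangle>), C_ob (K_ob A))"

definition beta :: "'u skanc_ob \<Rightarrow> ('u skanc_ob, 'u univ) arrow" where
  "beta T = (T, (\<lambda>x \<in> carrier T. \<langle>x \<squnion>\<^bsub>T\<^esub> \<cc>\<^bsub>T\<^esub>, \<sim>\<^bsub>T\<^esub> x \<squnion>\<^bsub>T\<^esub> \<cc>\<^bsub>T\<^esub>\<rangle>), K_ob (C_ob T))"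

end

theory Submission
  imports Defs
begin

text \<open>
  The idea is that an element of a centered KAN-algebra \<open>T\<close> is the same thing as a pair of elements
  above the center whose meet is the center. Over the Stone algebra \<open>A\<close>, think of \<open>(x, y)\<close> in \<open>K(A)\<close> as evidence \<open>x\<close> for a
  proposition together with evidence \<open>y\<close> against it. Joining with \<open>c = (0, 0)\<close> erases the evidence
  against, so \<open>x \<squnion> c\<close> retains the first half of \<open>x\<close> and \<open>\<sim> x \<squnion> c\<close> the second.

  The link between \<open>\<ominus>\<close> and the center is \<open>ineg_meet_center\<close>: below \<open>c\<close>, the two negations agree.
  By duality \<open>\<sim>(\<ominus> x) \<squnion> c = x \<squnion> c\<close>, so \<open>\<ominus> x\<close> determines \<open>x \<squnion> c\<close>. Three facts come out of this.
  First, \<open>\<ominus> y \<squnion> c\<close> is the pseudocomplement of \<open>y\<close> among the elements above \<open>c\<close>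
  (\<open>disjoint_above_center_iff\<close>), so \<open>C(T)\<close> is a p-algebra; the Stone identity passes to it because
  \<open>\<ominus> c = 1\<close>. Secondly, \<open>\<beta>\<close> preserves \<open>\<ominus>\<close>. Thirdly, \<open>\<beta>\<close> is onto: a pair \<open>a, b\<close> above \<open>c\<close> with
  \<open>a \<sqinter> b = c\<close> is the image of \<open>a \<sqinter> \<ominus> b\<close>. That \<open>\<beta>\<close> is one-to-one is cancellation in a
  distributive lattice: the two halves of \<open>x\<close> amount to \<open>x \<squnion> c\<close> and \<open>x \<sqinter> c\<close>.

  On the other side, \<open>K(A)\<close> is the product of the lattice \<open>A\<close> with its dual, cut down to the
  disjoint pairs, and the identities for \<open>\<ominus>\<close> reduce to properties of the pseudocomplement of \<open>A\<close>,
  which gives the first component of \<open>\<ominus>\<close>. A disjoint pair lies above \<open>(0, 0)\<close> exactly if its second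
  component is \<open>0\<close>, so \<open>\<alpha>\<close> is a bijection. As the inverse of a bijective homomorphism of algebras
  is a homomorphism, \<open>\<alpha>\<close> and \<open>\<beta>\<close> are isomorphisms, and naturality holds because homomorphisms
  commute with the operations that define them.
\<close>


section \<open>Bounded distributive lattices on a carrier\<close>

context bounded_distributive_lattice
begin

lemmas lattice_closed = join_closed meet_closed zero_closed one_closed

lemma meet_idem: "x \<in> carrier L \<Longrightarrow> x \<sqinter> x = x"
  using join_meet_absorb[of x x] meet_join_absorb[of x "x \<sqinter> x"] by (simp add: meet_closed)

lemma join_idem: "x \<in> carrier L \<Longrightarrow> x \<squnion> x = x"
  using join_meet_absorb[of x x] by (simp add: meet_idem)

lemma leq_iff_join: "\<lbrakk>x \<in> carrier L; y \<in> carrier L\<rbrakk> \<Longrightarrow> x \<sqsubseteq> y \<longleftrightarrow> x \<squnion> y = y"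
  unfolding leq_def using join_meet_absorb[of y x] meet_join_absorb[of x y]
  by (auto simp: join_comm[of x y] meet_comm[of y x])

lemma join_meet_distrib:
  assumes "x \<in> carrier L" "y \<in> carrier L" "z \<in> carrier L"
  shows "x \<squnion> (y \<sqinter> z) = (x \<squnion> y) \<sqinter> (x \<squnion> z)"
proof -
  have "(x \<squnion> y) \<sqinter> (x \<squnion> z) = ((x \<squnion> y) \<sqinter> x) \<squnion> ((x \<squnion> y) \<sqinter> z)"
    using assms by (simp add: meet_join_distrib lattice_closed)
  also have "(x \<squnion> y) \<sqinter> x = x"
    using assms by (simp add: meet_join_absorb meet_comm lattice_closed)
  also have "(x \<squnion> y) \<sqinter> z = (z \<sqinter> x) \<squnion> (y \<sqinter> z)"
    using assms by (simp add: meet_join_distrib meet_comm lattice_closed)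
  also have "x \<squnion> ((z \<sqinter> x) \<squnion> (y \<sqinter> z)) = (x \<squnion> (x \<sqinter> z)) \<squnion> (y \<sqinter> z)"
    using assms by (simp add: join_assoc lattice_closed meet_comm[of z x])
  finally show ?thesis
    using assms by (simp add: join_meet_absorb)
qed

lemma join_meet_distrib_right:
  "\<lbrakk>x \<in> carrier L; y \<in> carrier L; z \<in> carrier L\<rbrakk> \<Longrightarrow> (y \<sqinter> z) \<squnion> x = (y \<squnion> x) \<sqinter> (z \<squnion> x)"
  by (simp add: join_comm[of _ x] join_meet_distrib meet_closed)

lemma meet_join_distrib_right:
  "\<lbrakk>x \<in> carrier L; y \<in> carrier L; z \<in> carrier L\<rbrakk> \<Longrightarrow> (y \<squnion> z) \<sqinter> x = (y \<sqinter> x) \<squnion> (z \<sqinter> x)"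
  by (simp add: meet_comm[of _ x] meet_join_distrib join_closed)

lemma join_distrib_right:
  assumes "x \<in> carrier L" "y \<in> carrier L" "z \<in> carrier L"
  shows "(x \<squnion> y) \<squnion> z = (x \<squnion> z) \<squnion> (y \<squnion> z)"
proof -
  have "(x \<squnion> z) \<squnion> (y \<squnion> z) = x \<squnion> ((y \<squnion> z) \<squnion> z)"
    using assms by (simp add: join_assoc join_closed join_comm[of z "y \<squnion> z"])
  then show ?thesis
    using assms by (simp add: join_assoc join_closed join_idem)
qed

lemma leq_refl: "x \<in> carrier L \<Longrightarrow> x \<sqsubseteq> x"
  by (simp add: leq_def meet_idem)

lemma leq_antisym: "\<lbrakk>x \<sqsubseteq> y; y \<sqsubseteq> x; x \<in> carrier L; y \<in> carrier L\<rbrakk> \<Longrightarrow> x = y"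
  unfolding leq_def by (metis meet_comm)

lemma leq_trans:
  "\<lbrakk>x \<sqsubseteq> y; y \<sqsubseteq> z; x \<in> carrier L; y \<in> carrier L; z \<in> carrier L\<rbrakk> \<Longrightarrow> x \<sqsubseteq> z"
  unfolding leq_def by (metis meet_assoc)

lemma meet_leq1: "\<lbrakk>x \<in> carrier L; y \<in> carrier L\<rbrakk> \<Longrightarrow> x \<sqinter> y \<sqsubseteq> x"
  by (simp add: leq_def meet_comm[of "x \<sqinter> y" x] meet_assoc[symmetric] meet_idem meet_closed)

lemma meet_leq2: "\<lbrakk>x \<in> carrier L; y \<in> carrier L\<rbrakk> \<Longrightarrow> x \<sqinter> y \<sqsubseteq> y"
  by (simp add: leq_def meet_assoc meet_idem)

lemma leq_meetI:
  "\<lbrakk>z \<sqsubseteq> x; z \<sqsubseteq> y; x \<in> carrier L; y \<in> carrier L; z \<in> carrier L\<rbrakk> \<Longrightarrow> z \<sqsubseteq> x \<sqinter> y"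
  unfolding leq_def by (metis meet_assoc)

lemma leq_join1: "\<lbrakk>x \<in> carrier L; y \<in> carrier L\<rbrakk> \<Longrightarrow> x \<sqsubseteq> x \<squnion> y"
  by (simp add: leq_def meet_join_absorb)

lemma leq_join2: "\<lbrakk>x \<in> carrier L; y \<in> carrier L\<rbrakk> \<Longrightarrow> y \<sqsubseteq> x \<squnion> y"
  by (metis leq_join1 join_comm)

lemma zero_meet: "x \<in> carrier L \<Longrightarrow> \<zero> \<sqinter> x = \<zero>"
  using zero_least by (simp add: leq_def)

lemma meet_zero: "x \<in> carrier L \<Longrightarrow> x \<sqinter> \<zero> = \<zero>"
  using zero_meet by (metis meet_comm zero_closed)

lemma meet_one: "x \<in> carrier L \<Longrightarrow> x \<sqinter> \<one> = x"
  using one_greatest by (simp add: leq_def)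

lemma one_meet: "x \<in> carrier L \<Longrightarrow> \<one> \<sqinter> x = x"
  using meet_one by (metis meet_comm one_closed)

lemma zero_join: "x \<in> carrier L \<Longrightarrow> \<zero> \<squnion> x = x"
  using zero_least by (simp add: leq_iff_join zero_closed)

lemma join_zero: "x \<in> carrier L \<Longrightarrow> x \<squnion> \<zero> = x"
  using zero_join by (metis join_comm zero_closed)

lemma join_one: "x \<in> carrier L \<Longrightarrow> x \<squnion> \<one> = \<one>"
  using one_greatest by (simp add: leq_iff_join one_closed)

lemma one_join: "x \<in> carrier L \<Longrightarrow> \<one> \<squnion> x = \<one>"
  using join_one by (metis join_comm one_closed)

lemmas bound_simps = zero_meet meet_zero meet_one one_meet zero_join join_zero join_one one_join

lemma join_eq_zeroD:
  assumes "x \<in> carrier L" "y \<in> carrier L" "x \<squnion> y = \<zero>"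
  shows "x = \<zero> \<and> y = \<zero>"
  using assms(3) leq_join1[OF assms(1,2)] leq_join2[OF assms(1,2)] meet_zero assms(1,2)
  unfolding leq_def by metis

text \<open>
  In a distributive lattice, the relative complement of an element in an interval is unique. This
  is what makes \<open>\<beta>\<close> one-to-one.
\<close>

lemma join_meet_cancel:
  assumes "x \<in> carrier L" "y \<in> carrier L" "z \<in> carrier L"
    and "x \<squnion> z = y \<squnion> z" "x \<sqinter> z = y \<sqinter> z"
  shows "x = y"
proof -
  have "x = x \<sqinter> (y \<squnion> z)"
    using assms meet_join_absorb[of x z] by simp
  also have "\<dots> = (x \<sqinter> y) \<squnion> (y \<sqinter> z)"
    using assms by (simp add: meet_join_distrib)
  also have "\<dots> = y \<sqinter> (x \<squnion> z)"
    using assms(1-3) by (simp add: meet_join_distrib meet_comm[of y x] assms(5))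
  also have "\<dots> = y"
    using assms(1-3) by (simp add: meet_join_absorb assms(4))
  finally show ?thesis .
qed

end


section \<open>Pseudocomplements\<close>

context distributive_p_algebra
begin

lemmas p_closed = lattice_closed pcomp_closed

lemma meet_pcomp: "x \<in> carrier A \<Longrightarrow> x \<sqinter> \<star> x = \<zero>"
  using pcomp_iff[of "\<star> x" x] by (simp add: leq_refl meet_comm[of x] pcomp_closed)

lemma pcomp_join:
  assumes "x \<in> carrier A" "y \<in> carrier A"
  shows "\<star> (x \<squnion> y) = \<star> x \<sqinter> \<star> y"
proof (rule leq_antisym)
  have "\<star> (x \<squnion> y) \<sqinter> x \<squnion> \<star> (x \<squnion> y) \<sqinter> y = (x \<squnion> y) \<sqinter> \<star> (x \<squnion> y)"
    using assms by (simp add: meet_join_distrib meet_comm[of "x \<squnion> y"] lattice_closed pcomp_closed)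
  also have "\<dots> = \<zero>"
    using assms by (simp add: meet_pcomp lattice_closed)
  finally have "\<star> (x \<squnion> y) \<sqinter> x = \<zero> \<and> \<star> (x \<squnion> y) \<sqinter> y = \<zero>"
    using assms by (intro join_eq_zeroD) (simp_all add: lattice_closed pcomp_closed)
  then show "\<star> (x \<squnion> y) \<sqsubseteq> \<star> x \<sqinter> \<star> y"
    using assms by (simp add: leq_meetI pcomp_iff lattice_closed pcomp_closed)
  have "(\<star> x \<sqinter> \<star> y) \<sqinter> x = \<zero>"
    using assms
    by (metis meet_assoc meet_comm meet_pcomp pcomp_closed meet_zero)
  moreover have "(\<star> x \<sqinter> \<star> y) \<sqinter> y = \<zero>"
    using assms
    by (metis meet_assoc meet_comm meet_pcomp pcomp_closed meet_zero)
  ultimately have "(\<star> x \<sqinter> \<star> y) \<sqinter> (x \<squnion> y) = \<zero>"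
    using assms by (simp add: meet_join_distrib lattice_closed pcomp_closed join_idem)
  then show "\<star> x \<sqinter> \<star> y \<sqsubseteq> \<star> (x \<squnion> y)"
    using assms by (simp add: pcomp_iff lattice_closed pcomp_closed)
qed (use assms in \<open>simp_all add: lattice_closed pcomp_closed\<close>)

text \<open>
  Inside the principal ideal of \<open>x\<close>, being disjoint from \<open>x \<sqinter> y\<close> and being disjoint from \<open>y\<close> are
  the same condition. For \<open>K(A)\<close> this is the identity (N1).
\<close>

lemma meet_pcomp_meet:
  assumes "x \<in> carrier A" "y \<in> carrier A"
  shows "x \<sqinter> \<star> (x \<sqinter> y) = x \<sqinter> \<star> y"
proof (rule leq_antisym)
  have "(x \<sqinter> \<star> (x \<sqinter> y)) \<sqinter> y = (x \<sqinter> y) \<sqinter> \<star> (x \<sqinter> y)"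
    using assms by (metis meet_assoc meet_comm meet_closed pcomp_closed)
  then have "x \<sqinter> \<star> (x \<sqinter> y) \<sqsubseteq> \<star> y"
    using assms by (simp add: meet_pcomp pcomp_iff[symmetric] lattice_closed pcomp_closed)
  then show "x \<sqinter> \<star> (x \<sqinter> y) \<sqsubseteq> x \<sqinter> \<star> y"
    using assms by (simp add: leq_meetI meet_leq1 lattice_closed pcomp_closed)
  have "(x \<sqinter> \<star> y) \<sqinter> (x \<sqinter> y) = \<zero>"
    using assms
    by (metis meet_assoc meet_comm meet_pcomp pcomp_closed meet_zero meet_closed)
  then have "x \<sqinter> \<star> y \<sqsubseteq> \<star> (x \<sqinter> y)"
    using assms by (simp add: pcomp_iff lattice_closed pcomp_closed)
  then show "x \<sqinter> \<star> y \<sqsubseteq> x \<sqinter> \<star> (x \<sqinter> y)"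
    using assms by (simp add: leq_meetI meet_leq1 lattice_closed pcomp_closed)
qed (use assms in \<open>simp_all add: lattice_closed pcomp_closed\<close>)

end


section \<open>Centered KAN-algebras\<close>

context kleene_algebra
begin

lemma kneg_meet:
  assumes "x \<in> carrier T" "y \<in> carrier T"
  shows "\<sim> (x \<sqinter> y) = \<sim> x \<squnion> \<sim> y"
  using assms kneg_join[of "\<sim> x" "\<sim> y"] kneg_kneg[of "\<sim> x \<squnion> \<sim> y"]
  by (simp add: kneg_closed kneg_kneg join_closed)

lemma kneg_zero: "\<sim> \<zero> = \<one>"
  using kneg_join[of \<zero> "\<sim> \<one>"]
  by (simp add: kneg_kneg kneg_closed lattice_closed bound_simps)

lemma kneg_one: "\<sim> \<one> = \<zero>"
  using kneg_kneg[OF zero_closed] by (simp add: kneg_zero)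

end

context kan_algebra
begin

lemma ineg_zero: "\<ominus> \<zero> = \<one>"
  using N4[OF zero_closed] by (simp add: kneg_zero leq_def one_meet ineg_closed zero_closed)

lemma ineg_one: "\<ominus> \<one> = \<zero>"
  using N3[OF one_closed] by (simp add: kneg_one one_meet ineg_closed lattice_closed)

text \<open>
  The law of non-contradiction for \<open>\<ominus>\<close>, obtained from (N1) with \<open>y = 1\<close>.
\<close>

lemma ineg_meet_ineg: "x \<in> carrier T \<Longrightarrow> \<ominus> (x \<sqinter> \<ominus> x) = \<one>"
  using N1[of x \<one>] by (simp add: lattice_closed bound_simps ineg_one ineg_zero)

end

context centered_kan_algebra
begin

lemmas kan_closed = lattice_closed kneg_closed ineg_closed center_closed

lemma meet_kneg_leq_center: "x \<in> carrier T \<Longrightarrow> x \<sqinter> \<sim> x \<sqsubseteq> \<cc>"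
  using kleene[of x \<cc>] by (simp add: kneg_center center_closed join_idem)

lemma center_leq_join_kneg: "x \<in> carrier T \<Longrightarrow> \<cc> \<sqsubseteq> x \<squnion> \<sim> x"
  using kleene[of \<cc> x] by (simp add: kneg_center center_closed meet_idem)

text \<open>
  Since \<open>\<sim> c = c\<close>, (N3) turns \<open>c = c \<sqinter> \<sim> c\<close> into \<open>c = c \<sqinter> \<ominus> c\<close>, and \<open>\<ominus>\<close> sends every
  \<open>x \<sqinter> \<ominus> x\<close> to \<open>1\<close>. Consequently joining with \<open>c\<close> does not change the value of \<open>\<ominus>\<close>.
\<close>

lemma ineg_center: "\<ominus> \<cc> = \<one>"
  using ineg_meet_ineg[OF center_closed] N3[OF center_closed]
  by (simp add: kneg_center center_closed meet_idem)

lemma ineg_join_center: "x \<in> carrier T \<Longrightarrow> \<ominus> (x \<squnion> \<cc>) = \<ominus> x"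
  by (simp add: N2 ineg_center kan_closed bound_simps)

lemma kneg_meet_center: "x \<in> carrier T \<Longrightarrow> \<sim> (x \<sqinter> \<cc>) = \<sim> x \<squnion> \<cc>"
  by (simp add: kneg_meet kneg_center center_closed)

lemma kneg_join_center: "x \<in> carrier T \<Longrightarrow> \<sim> (x \<squnion> \<cc>) = \<sim> x \<sqinter> \<cc>"
  by (simp add: kneg_join kneg_center center_closed)

text \<open>
  By the Kleene identity \<open>c\<close> lies below \<open>x \<squnion> \<sim> x\<close>. Hence the part of \<open>\<ominus> x\<close> below \<open>c\<close> splits
  into a part below \<open>x \<sqinter> \<ominus> x\<close> and a part below \<open>\<sim> x\<close>; by (N3) the former is below \<open>\<sim> x\<close> as
  well. The converse inequality is (N4).
\<close>

lemma ineg_meet_center: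
  assumes x: "x \<in> carrier T"
  shows "\<ominus> x \<sqinter> \<cc> = \<sim> x \<sqinter> \<cc>"
proof (rule leq_antisym)
  have "\<ominus> x \<sqinter> \<cc> \<sqsubseteq> \<ominus> x \<sqinter> (x \<squnion> \<sim> x)"
    using x center_leq_join_kneg[OF x]
    by (meson kan_closed leq_meetI leq_trans meet_leq1 meet_leq2)
  also have "\<ominus> x \<sqinter> (x \<squnion> \<sim> x) = (x \<sqinter> \<ominus> x) \<squnion> (\<sim> x \<sqinter> \<ominus> x)"
    using x by (simp add: meet_join_distrib meet_comm kan_closed)
  also have "\<dots> = (x \<sqinter> \<sim> x) \<squnion> \<sim> x"
    using x N4[OF x] N3[OF x] by (simp add: leq_def)
  also have "\<dots> = \<sim> x"
    using x meet_leq2[of x "\<sim> x"] by (simp add: leq_iff_join kan_closed)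
  finally show "\<ominus> x \<sqinter> \<cc> \<sqsubseteq> \<sim> x \<sqinter> \<cc>"
    using x by (simp add: leq_meetI meet_leq2 kan_closed)
  show "\<sim> x \<sqinter> \<cc> \<sqsubseteq> \<ominus> x \<sqinter> \<cc>"
    using x N4[OF x] by (meson kan_closed leq_meetI leq_trans meet_leq1 meet_leq2)
qed (use x in \<open>simp_all add: kan_closed\<close>)

lemma kneg_ineg_join_center: "x \<in> carrier T \<Longrightarrow> \<sim> (\<ominus> x) \<squnion> \<cc> = x \<squnion> \<cc>"
  by (metis ineg_closed ineg_meet_center kneg_closed kneg_kneg kneg_meet_center)

lemma join_center_determined_by_ineg:
  "\<lbrakk>x \<in> carrier T; y \<in> carrier T; \<ominus> x = \<ominus> y\<rbrakk> \<Longrightarrow> x \<squnion> \<cc> = y \<squnion> \<cc>"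
  by (metis kneg_ineg_join_center)

text \<open>
  If \<open>x \<sqinter> y = c\<close>, then \<open>\<ominus> (x \<sqinter> y) = 1\<close> and (N1) reduces to \<open>\<ominus> x = \<ominus> (x \<sqinter> \<ominus> y)\<close>. As \<open>\<ominus>\<close>
  determines elements up to joining with \<open>c\<close>, this says \<open>x = (x \<sqinter> \<ominus> y) \<squnion> c\<close>. Conversely
  \<open>x \<sqsubseteq> \<ominus> y \<squnion> c\<close> bounds \<open>x \<sqinter> y\<close> by \<open>(y \<sqinter> \<sim> y) \<squnion> c\<close>, which is \<open>c\<close>.
\<close>

lemma disjoint_above_center_iff:
  assumes x: "x \<in> carrier T" "\<cc> \<sqsubseteq> x" and y: "y \<in> carrier T" "\<cc> \<sqsubseteq> y"
  shows "x \<sqinter> y = \<cc> \<longleftrightarrow> x \<sqsubseteq> \<ominus> y \<squnion> \<cc>"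
proof
  assume "x \<sqinter> y = \<cc>"
  then have "\<ominus> (x \<sqinter> \<ominus> y) = \<ominus> x"
    using x y N1[of x y] by (simp add: ineg_center bound_simps kan_closed)
  then have "(x \<sqinter> \<ominus> y) \<squnion> \<cc> = x \<squnion> \<cc>"
    using x y by (intro join_center_determined_by_ineg) (simp_all add: kan_closed)
  also have "x \<squnion> \<cc> = x"
    using x by (simp add: leq_iff_join join_comm kan_closed)
  finally have "x = (x \<sqinter> \<ominus> y) \<squnion> \<cc>" ..
  also have "\<dots> = (x \<squnion> \<cc>) \<sqinter> (\<ominus> y \<squnion> \<cc>)"
    using x y by (simp add: join_meet_distrib_right kan_closed)
  finally show "x \<sqsubseteq> \<ominus> y \<squnion> \<cc>"
    using x y by (metis kan_closed(1) center_closed ineg_closed meet_leq2)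
next
  assume leq: "x \<sqsubseteq> \<ominus> y \<squnion> \<cc>"
  have "x \<sqinter> y \<sqsubseteq> (\<ominus> y \<squnion> \<cc>) \<sqinter> y"
    using x y leq by (meson kan_closed leq_meetI leq_trans meet_leq1 meet_leq2)
  also have "(\<ominus> y \<squnion> \<cc>) \<sqinter> y = (y \<sqinter> \<sim> y) \<squnion> \<cc>"
    using y N3[of y] by (simp add: meet_join_distrib_right meet_comm[of "\<ominus> y" y] kan_closed leq_def)
  also have "\<dots> = \<cc>"
    using y meet_kneg_leq_center[of y] by (simp add: leq_iff_join kan_closed)
  finally show "x \<sqinter> y = \<cc>"
    using x y by (meson leq_antisym leq_meetI kan_closed)
qed

end

section \<open>Categories of algebras\<close>

text \<open>
  What both categories of algebras have in common: \<open>X\<close> is the class of algebras and \<open>H\<close> the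
  homomorphisms. The last condition distinguishes algebras from, say, ordered sets or topological
  spaces; it makes the bijective homomorphisms isomorphisms.
\<close>

locale algebraic_homs =
  fixes X :: "('a, 'b) partial_object_scheme set"
    and H :: "('a, 'b) partial_object_scheme \<Rightarrow> ('a, 'b) partial_object_scheme \<Rightarrow> ('a \<Rightarrow> 'a) set"
  assumes hom_funcset: "h \<in> H A B \<Longrightarrow> h \<in> carrier A \<rightarrow>\<^sub>E carrier B"
    and hom_ident: "A \<in> X \<Longrightarrow> (\<lambda>x \<in> carrier A. x) \<in> H A A"
    and hom_compose: "\<lbrakk>A \<in> X; h \<in> H A B; g \<in> H B D\<rbrakk> \<Longrightarrow> compose (carrier A) g h \<in> H A D"
    and hom_inverse: "\<lbrakk>A \<in> X; h \<in> H A B; g \<in> carrier B \<rightarrow>\<^sub>E carrier A;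
        \<And>x. x \<in> carrier A \<Longrightarrow> g (h x) = x; \<And>y. y \<in> carrier B \<Longrightarrow> h (g y) = y\<rbrakk> \<Longrightarrow> g \<in> H B A"
begin

lemma concrete_category: "category (concrete_category X H)"
proof (unfold_locales, goal_cases)
  \<comment> \<open>For the unit and associativity laws, both sides must be \<open>undefined\<close> outside the carrier.\<close>
  case (9 f)
  then show ?case
    by (auto simp: concrete_category_def compose_def PiE_iff intro!: extensionalityI[of _ "carrier (arr_dom f)"]
        dest!: hom_funcset)
next
  case (10 f)
  then show ?case
    by (auto simp: concrete_category_def compose_def PiE_iff intro!: extensionalityI[of _ "carrier (arr_dom f)"]
        dest!: hom_funcset)
next
  case (11 f g h)
  then show ?case
    by (auto simp: concrete_category_def compose_def PiE_mem dest!: hom_funcset intro!: restrict_ext)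
qed (auto simp: concrete_category_def hom_ident hom_compose)

lemma isomorphism_if_bij_betw:
  assumes "A \<in> X" "B \<in> X" and h: "h \<in> H A B" and bij: "bij_betw h (carrier A) (carrier B)"
  shows "isomorphism (concrete_category X H) (A, h, B)"
proof -
  define g where "g = (\<lambda>y \<in> carrier B. inv_into (carrier A) h y)"
  have gh: "g (h x) = x" if "x \<in> carrier A" for x
    using that bij unfolding g_def by (simp add: bij_betw_inv_into_left bij_betwE)
  have hg: "h (g y) = y" if "y \<in> carrier B" for y
    using that bij unfolding g_def by (simp add: bij_betw_inv_into_right)
  have g_fun: "g \<in> carrier B \<rightarrow>\<^sub>E carrier A"
    using bij unfolding g_def by (auto simp: bij_betw_def intro: inv_into_into)
  have g: "g \<in> H B A"
    using assms(1) h g_fun gh hg by (rule hom_inverse)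
  have "compose (carrier A) g h = (\<lambda>x \<in> carrier A. x)"
    and "compose (carrier B) h g = (\<lambda>x \<in> carrier B. x)"
    using gh hg by (auto simp: compose_def)
  then show ?thesis
    using assms g unfolding isomorphism_def concrete_category_def
    by (auto intro!: bexI[of _ "(B, g, A)"])
qed

end

lemma covariant_functor_id: "category C \<Longrightarrow> covariant_functor C C id_functor"
  unfolding covariant_functor_def covariant_functor_axioms_def id_functor_def
  by (auto intro: category.Dom_Ob category.Cod_Ob)

lemma covariant_functor_comp:
  assumes "covariant_functor C D F" "covariant_functor D E G"
  shows "covariant_functor C E (comp_functor G F)"
proof -
  interpret F: covariant_functor C D F by fact
  interpret G: covariant_functor D E G by fact
  show ?thesis
    by unfold_locales
      (simp_all add: comp_functor_def F.on_ob_Ob F.on_arr_Arr F.Dom_on_arr F.Cod_on_arr F.on_arr_Id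
        F.on_arr_Comp G.on_ob_Ob G.on_arr_Arr G.Dom_on_arr G.Cod_on_arr G.on_arr_Id G.on_arr_Comp)
qed

lemma bdl_hom_ident:
  "bounded_distributive_lattice L \<Longrightarrow> (\<lambda>x \<in> carrier L. x) \<in> bdl_hom L L"
  by (auto simp: bdl_hom_def bounded_distributive_lattice.lattice_closed)

lemma bdl_homD:
  assumes "h \<in> bdl_hom L M"
  shows "x \<in> carrier L \<Longrightarrow> h x \<in> carrier M"
    and "\<lbrakk>x \<in> carrier L; y \<in> carrier L\<rbrakk> \<Longrightarrow> h (x \<squnion>\<^bsub>L\<^esub> y) = h x \<squnion>\<^bsub>M\<^esub> h y"
    and "\<lbrakk>x \<in> carrier L; y \<in> carrier L\<rbrakk> \<Longrightarrow> h (x \<sqinter>\<^bsub>L\<^esub> y) = h x \<sqinter>\<^bsub>M\<^esub> h y"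
    and "h \<zero>\<^bsub>L\<^esub> = \<zero>\<^bsub>M\<^esub>" and "h \<one>\<^bsub>L\<^esub> = \<one>\<^bsub>M\<^esub>"
  using assms by (auto simp: bdl_hom_def)

lemma p_homD:
  assumes "h \<in> p_hom A B"
  shows "h \<in> bdl_hom A B" and "x \<in> carrier A \<Longrightarrow> h (\<star>\<^bsub>A\<^esub> x) = \<star>\<^bsub>B\<^esub> (h x)"
  using assms by (auto simp: p_hom_def)

lemma kanc_homD:
  assumes "f \<in> kanc_hom T S"
  shows "f \<in> bdl_hom T S"
    and "x \<in> carrier T \<Longrightarrow> f (\<sim>\<^bsub>T\<^esub> x) = \<sim>\<^bsub>S\<^esub> (f x)"
    and "x \<in> carrier T \<Longrightarrow> f (\<ominus>\<^bsub>T\<^esub> x) = \<ominus>\<^bsub>S\<^esub> (f x)"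
    and "f \<cc>\<^bsub>T\<^esub> = \<cc>\<^bsub>S\<^esub>"
  using assms by (auto simp: kanc_hom_def)

lemma bdl_hom_compose:
  assumes "bounded_distributive_lattice L" "h \<in> bdl_hom L M" "g \<in> bdl_hom M N"
  shows "compose (carrier L) g h \<in> bdl_hom L N"
proof -
  interpret bounded_distributive_lattice L by fact
  note h = bdl_homD[OF assms(2)] and g = bdl_homD[OF assms(3)]
  show ?thesis
    by (auto simp: bdl_hom_def compose_def lattice_closed h g)
qed

lemma bdl_hom_inverse:
  assumes "bounded_distributive_lattice L" and h: "h \<in> bdl_hom L M"
    and g: "g \<in> carrier M \<rightarrow>\<^sub>E carrier L"
    and gh: "\<And>x. x \<in> carrier L \<Longrightarrow> g (h x) = x" and hg: "\<And>y. y \<in> carrier M \<Longrightarrow> h (g y) = y"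
  shows "g \<in> bdl_hom M L"
proof -
  interpret bounded_distributive_lattice L by fact
  have "g (x \<squnion>\<^bsub>M\<^esub> y) = g x \<squnion>\<^bsub>L\<^esub> g y" "g (x \<sqinter>\<^bsub>M\<^esub> y) = g x \<sqinter>\<^bsub>L\<^esub> g y"
    if xy: "x \<in> carrier M" "y \<in> carrier M" for x y
  proof -
    have gxy: "g x \<in> carrier L" "g y \<in> carrier L"
      using xy g by auto
    then have "h (g x \<squnion>\<^bsub>L\<^esub> g y) = x \<squnion>\<^bsub>M\<^esub> y" "h (g x \<sqinter>\<^bsub>L\<^esub> g y) = x \<sqinter>\<^bsub>M\<^esub> y"
      using h xy by (simp_all add: bdl_hom_def hg)
    then show "g (x \<squnion>\<^bsub>M\<^esub> y) = g x \<squnion>\<^bsub>L\<^esub> g y" "g (x \<sqinter>\<^bsub>M\<^esub> y) = g x \<sqinter>\<^bsub>L\<^esub> g y"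
      using gxy gh by (metis join_closed, metis meet_closed)
  qed
  moreover have "g \<zero>\<^bsub>M\<^esub> = \<zero>\<^bsub>L\<^esub>" "g \<one>\<^bsub>M\<^esub> = \<one>\<^bsub>L\<^esub>"
    using h gh[OF zero_closed] gh[OF one_closed] by (simp_all add: bdl_hom_def)
  ultimately show ?thesis
    using g by (simp add: bdl_hom_def)
qed

lemma p_hom_algebraic: "algebraic_homs {A. stone_algebra A} p_hom"
proof (unfold_locales, goal_cases)
  case (1 h A B)
  then show ?case by (simp add: p_hom_def bdl_hom_def)
next
  case (2 A)
  then interpret stone_algebra A by simp
  show ?case
    using bdl_hom_ident[OF bounded_distributive_lattice_axioms] by (auto simp: p_hom_def pcomp_closed)
next
  case (3 A h B g D)
  then interpret stone_algebra A by simp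
  have "h x \<in> carrier B" if "x \<in> carrier A" for x
    using 3 that by (auto simp: p_hom_def bdl_hom_def)
  then show ?case
    using 3 bdl_hom_compose[OF bounded_distributive_lattice_axioms]
    by (auto simp: p_hom_def pcomp_closed compose_def)
next
  case (4 A h B g)
  then interpret stone_algebra A by simp
  have "g (\<star>\<^bsub>B\<^esub> y) = \<star>\<^bsub>A\<^esub> (g y)" if y: "y \<in> carrier B" for y
  proof -
    have gy: "g y \<in> carrier A"
      using y 4(3) by auto
    then have "h (\<star>\<^bsub>A\<^esub> (g y)) = \<star>\<^bsub>B\<^esub> y"
      using y 4 by (simp add: p_hom_def)
    then show ?thesis
      using 4(4)[OF pcomp_closed[OF gy]] by simp
  qed
  moreover have "g \<in> bdl_hom B A"
    using 4 by (intro bdl_hom_inverse[OF bounded_distributive_lattice_axioms]) (auto simp: p_hom_def)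
  ultimately show ?case
    by (simp add: p_hom_def)
qed

lemma kanc_hom_algebraic: "algebraic_homs {T. centered_stone_kan_algebra T} kanc_hom"
proof (unfold_locales, goal_cases)
  case (1 h A B)
  then show ?case by (simp add: kanc_hom_def bdl_hom_def)
next
  case (2 A)
  then interpret centered_stone_kan_algebra A by simp
  show ?case
    using bdl_hom_ident[OF bounded_distributive_lattice_axioms] by (auto simp: kanc_hom_def kan_closed)
next
  case (3 A h B g D)
  then interpret centered_stone_kan_algebra A by simp
  have "h x \<in> carrier B" if "x \<in> carrier A" for x
    using 3 that by (auto simp: kanc_hom_def bdl_hom_def)
  then show ?case
    using 3 bdl_hom_compose[OF bounded_distributive_lattice_axioms]
    by (auto simp: kanc_hom_def kan_closed compose_def)
next
  case (4 A h B g)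
  then interpret centered_stone_kan_algebra A by simp
  have "g (\<sim>\<^bsub>B\<^esub> y) = \<sim>\<^bsub>A\<^esub> (g y)" "g (\<ominus>\<^bsub>B\<^esub> y) = \<ominus>\<^bsub>A\<^esub> (g y)" if y: "y \<in> carrier B" for y
  proof -
    have gy: "g y \<in> carrier A"
      using y 4(3) by auto
    then have "h (\<sim>\<^bsub>A\<^esub> (g y)) = \<sim>\<^bsub>B\<^esub> y" "h (\<ominus>\<^bsub>A\<^esub> (g y)) = \<ominus>\<^bsub>B\<^esub> y"
      using y 4 by (simp_all add: kanc_hom_def)
    then show "g (\<sim>\<^bsub>B\<^esub> y) = \<sim>\<^bsub>A\<^esub> (g y)" "g (\<ominus>\<^bsub>B\<^esub> y) = \<ominus>\<^bsub>A\<^esub> (g y)"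
      using 4(4)[OF kneg_closed[OF gy]] 4(4)[OF ineg_closed[OF gy]] by simp_all
  qed
  moreover have "g \<cc>\<^bsub>B\<^esub> = \<cc>\<^bsub>A\<^esub>"
    using 4(2) 4(4)[OF center_closed] by (simp add: kanc_hom_def)
  moreover have "g \<in> bdl_hom B A"
    using 4 by (intro bdl_hom_inverse[OF bounded_distributive_lattice_axioms]) (auto simp: kanc_hom_def)
  ultimately show ?case
    by (simp add: kanc_hom_def)
qed


section \<open>The functor K\<close>

text \<open>
  Pairs are kept in the form \<open>\<langle>x, y\<rangle>\<close> throughout, so that each law of \<open>K(A)\<close> falls apart into one law
  of \<open>A\<close> for the first components and one, in the dual lattice, for the second components.
\<close>

lemma K_ob_simps [simp]:
  "\<langle>x, y\<rangle> \<in> carrier (K_ob A) \<longleftrightarrow> x \<in> carrier A \<and> y \<in> carrier A \<and> x \<sqinter>\<^bsub>A\<^esub> y = \<zero>\<^bsub>A\<^esub>"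
  "\<langle>x, y\<rangle> \<squnion>\<^bsub>K_ob A\<^esub> \<langle>x', y'\<rangle> = \<langle>x \<squnion>\<^bsub>A\<^esub> x', y \<sqinter>\<^bsub>A\<^esub> y'\<rangle>"
  "\<langle>x, y\<rangle> \<sqinter>\<^bsub>K_ob A\<^esub> \<langle>x', y'\<rangle> = \<langle>x \<sqinter>\<^bsub>A\<^esub> x', y \<squnion>\<^bsub>A\<^esub> y'\<rangle>"
  "\<zero>\<^bsub>K_ob A\<^esub> = \<langle>\<zero>\<^bsub>A\<^esub>, \<one>\<^bsub>A\<^esub>\<rangle>"
  "\<one>\<^bsub>K_ob A\<^esub> = \<langle>\<one>\<^bsub>A\<^esub>, \<zero>\<^bsub>A\<^esub>\<rangle>"
  "\<sim>\<^bsub>K_ob A\<^esub> \<langle>x, y\<rangle> = \<langle>y, x\<rangle>"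
  "\<ominus>\<^bsub>K_ob A\<^esub> \<langle>x, y\<rangle> = \<langle>\<star>\<^bsub>A\<^esub> x, x\<rangle>"
  "\<cc>\<^bsub>K_ob A\<^esub> = \<langle>\<zero>\<^bsub>A\<^esub>, \<zero>\<^bsub>A\<^esub>\<rangle>"
  by (simp_all add: K_ob_def)

lemma K_ob_cases:
  assumes "p \<in> carrier (K_ob A)"
  obtains x y where "p = \<langle>x, y\<rangle>" "x \<in> carrier A" "y \<in> carrier A" "x \<sqinter>\<^bsub>A\<^esub> y = \<zero>\<^bsub>A\<^esub>"
  using assms by (auto simp: K_ob_def)

lemma K_ob_leq:
  assumes "stone_algebra A" "\<langle>x, y\<rangle> \<in> carrier (K_ob A)" "\<langle>x', y'\<rangle> \<in> carrier (K_ob A)"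
  shows "\<langle>x, y\<rangle> \<sqsubseteq>\<^bsub>K_ob A\<^esub> \<langle>x', y'\<rangle> \<longleftrightarrow> x \<sqsubseteq>\<^bsub>A\<^esub> x' \<and> y' \<sqsubseteq>\<^bsub>A\<^esub> y"
proof -
  interpret stone_algebra A by fact
  show ?thesis
    using assms(2,3) leq_iff_join[of y' y] by (simp add: leq_def join_comm)
qed

text \<open>
  The laws hold in the product of \<open>A\<close> with its dual, so the point is that disjointness of pairs is
  preserved: \<open>x \<squnion> x'\<close> is disjoint from \<open>y \<sqinter> y'\<close> by distributivity, and the case of meets is
  symmetric.
\<close>

lemma K_ob_bounded_distributive_lattice:
  assumes "stone_algebra A"
  shows "bounded_distributive_lattice (K_ob A)"
proof -
  interpret stone_algebra A by fact
  have join: "(x \<squnion>\<^bsub>A\<^esub> x') \<sqinter>\<^bsub>A\<^esub> (y \<sqinter>\<^bsub>A\<^esub> y') = \<zero>\<^bsub>A\<^esub>"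
    if "x \<in> carrier A" "x' \<in> carrier A" "y \<in> carrier A" "y' \<in> carrier A"
      "x \<sqinter>\<^bsub>A\<^esub> y = \<zero>\<^bsub>A\<^esub>" "x' \<sqinter>\<^bsub>A\<^esub> y' = \<zero>\<^bsub>A\<^esub>" for x x' y y'
  proof -
    have "x \<sqinter>\<^bsub>A\<^esub> (y \<sqinter>\<^bsub>A\<^esub> y') = \<zero>\<^bsub>A\<^esub>"
      using that by (simp add: meet_assoc[symmetric] bound_simps)
    moreover have "x' \<sqinter>\<^bsub>A\<^esub> (y \<sqinter>\<^bsub>A\<^esub> y') = \<zero>\<^bsub>A\<^esub>"
      using that by (simp add: meet_comm[of y y'] meet_assoc[symmetric] bound_simps)
    ultimately show ?thesis
      using that by (simp add: meet_join_distrib_right p_closed bound_simps)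
  qed
  have meet: "(y \<sqinter>\<^bsub>A\<^esub> y') \<sqinter>\<^bsub>A\<^esub> (x \<squnion>\<^bsub>A\<^esub> x') = \<zero>\<^bsub>A\<^esub>"
    if "x \<in> carrier A" "x' \<in> carrier A" "y \<in> carrier A" "y' \<in> carrier A"
      "y \<sqinter>\<^bsub>A\<^esub> x = \<zero>\<^bsub>A\<^esub>" "y' \<sqinter>\<^bsub>A\<^esub> x' = \<zero>\<^bsub>A\<^esub>" for x x' y y'
    using join[of x x' y y'] that by (simp add: meet_comm p_closed)
  show ?thesis
  proof (unfold_locales, goal_cases)
    case (1 p q)
    then show ?case by (elim K_ob_cases) (simp add: join p_closed)
  next
    case (2 p q)
    then show ?case by (elim K_ob_cases) (simp add: meet p_closed)
  next
    case (7 p q)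
    then show ?case by (elim K_ob_cases) (simp add: join_comm meet_comm)
  next
    case (8 p q)
    then show ?case by (elim K_ob_cases) (simp add: join_comm meet_comm)
  next
    case (11 p q r)
    then show ?case
      by (elim K_ob_cases) (simp, intro conjI meet_join_distrib join_meet_distrib)
  qed (auto elim!: K_ob_cases simp: p_closed bound_simps join_assoc meet_assoc
        join_meet_absorb meet_join_absorb leq_def)
qed

text \<open>
  The second component of \<open>\<ominus> p\<close> is the first component of \<open>p\<close>, so two values of \<open>\<ominus>\<close> are equal
  once the first components of the arguments are. Thus (N1) reduces to \<open>meet_pcomp_meet\<close> and (N5)
  is immediate, \<open>\<sim>(\<ominus> p)\<close> having the same first component as \<open>p\<close>. For (N4), disjointness of
  \<open>\<langle>x, y\<rangle>\<close> means that \<open>y\<close> is below the pseudocomplement of \<open>x\<close>.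
\<close>

lemma K_ob_centered_stone_kan_algebra:
  assumes "stone_algebra A"
  shows "centered_stone_kan_algebra (K_ob A)"
proof -
  interpret stone_algebra A by fact
  interpret K: bounded_distributive_lattice "K_ob A"
    using assms by (rule K_ob_bounded_distributive_lattice)
  show ?thesis
  proof (unfold_locales, goal_cases)
    case (4 p q)
    then show ?case
      by (auto elim!: K_ob_cases simp: leq_def p_closed bound_simps meet_comm)
  next
    case (6 p q)
    then show ?case
      by (auto elim!: K_ob_cases simp: meet_pcomp_meet p_closed)
  next
    case (9 p)
    then show ?case
      using assms
      by (auto elim!: K_ob_cases simp: K_ob_leq leq_refl pcomp_iff[symmetric] meet_comm meet_pcomp p_closed)
  qed (auto elim!: K_ob_cases simp: p_closed bound_simps meet_comm meet_pcomp pcomp_join join_comm stone)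
qed

lemma K_hom:
  assumes "stone_algebra A" "h \<in> p_hom A B"
  shows "(\<lambda>p \<in> carrier (K_ob A). \<langle>h (pfst p), h (psnd p)\<rangle>) \<in> kanc_hom (K_ob A) (K_ob B)"
proof -
  interpret stone_algebra A by fact
  interpret K: centered_stone_kan_algebra "K_ob A"
    using assms(1) by (rule K_ob_centered_stone_kan_algebra)
  note hom = bdl_homD[OF p_homD(1)[OF assms(2)]] p_homD(2)[OF assms(2)]
  have disjoint: "h x \<sqinter>\<^bsub>B\<^esub> h y = \<zero>\<^bsub>B\<^esub>"
    if "x \<in> carrier A" "y \<in> carrier A" "x \<sqinter>\<^bsub>A\<^esub> y = \<zero>\<^bsub>A\<^esub>" for x y
    using that by (metis hom(3,4))
  show ?thesis
    using K.kan_closed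
    by (auto elim!: K_ob_cases simp: kanc_hom_def bdl_hom_def hom disjoint p_closed)
qed

section \<open>The functor C\<close>

lemma C_ob_simps [simp]:
  "x \<in> carrier (C_ob T) \<longleftrightarrow> x \<in> carrier T \<and> \<cc>\<^bsub>T\<^esub> \<sqsubseteq>\<^bsub>T\<^esub> x"
  "x \<squnion>\<^bsub>C_ob T\<^esub> y = x \<squnion>\<^bsub>T\<^esub> y"
  "x \<sqinter>\<^bsub>C_ob T\<^esub> y = x \<sqinter>\<^bsub>T\<^esub> y"
  "\<zero>\<^bsub>C_ob T\<^esub> = \<cc>\<^bsub>T\<^esub>"
  "\<one>\<^bsub>C_ob T\<^esub> = \<one>\<^bsub>T\<^esub>"
  "\<star>\<^bsub>C_ob T\<^esub> x = \<ominus>\<^bsub>T\<^esub> x \<squnion>\<^bsub>T\<^esub> \<cc>\<^bsub>T\<^esub>"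
  "x \<sqsubseteq>\<^bsub>C_ob T\<^esub> y \<longleftrightarrow> x \<sqsubseteq>\<^bsub>T\<^esub> y"
  by (simp_all add: C_ob_def leq_def)

lemma C_ob_stone_algebra:
  assumes "centered_stone_kan_algebra T"
  shows "stone_algebra (C_ob T)"
proof -
  interpret centered_stone_kan_algebra T by fact
  have joined: "\<cc>\<^bsub>T\<^esub> \<sqsubseteq>\<^bsub>T\<^esub> x \<squnion>\<^bsub>T\<^esub> \<cc>\<^bsub>T\<^esub>" if "x \<in> carrier T" for x
    using that by (simp add: leq_join2 kan_closed)
  have join: "\<cc>\<^bsub>T\<^esub> \<sqsubseteq>\<^bsub>T\<^esub> x \<squnion>\<^bsub>T\<^esub> y"
    if "x \<in> carrier T" "y \<in> carrier T" "\<cc>\<^bsub>T\<^esub> \<sqsubseteq>\<^bsub>T\<^esub> x" for x y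
    using that by (meson leq_trans leq_join1 kan_closed)
  show ?thesis
  proof (unfold_locales, goal_cases)
    case (7 x y)
    then show ?case by (simp add: join_comm)
  next
    case (8 x y)
    then show ?case by (simp add: meet_comm)
  next
    case (15 x y)
    then show ?case by (simp add: disjoint_above_center_iff)
  next
    case (16 x)
    then have x: "x \<in> carrier T" by simp
    \<comment> \<open>The inner joins with the center disappear, so this is the Stone identity of \<open>T\<close> joined with it.\<close>
    have "\<ominus>\<^bsub>T\<^esub> (\<ominus>\<^bsub>T\<^esub> x \<squnion>\<^bsub>T\<^esub> \<cc>\<^bsub>T\<^esub>) = \<ominus>\<^bsub>T\<^esub> (\<ominus>\<^bsub>T\<^esub> x)"
      using x by (simp add: ineg_join_center kan_closed)
    moreover have "(\<ominus>\<^bsub>T\<^esub> x \<squnion>\<^bsub>T\<^esub> \<cc>\<^bsub>T\<^esub>) \<squnion>\<^bsub>T\<^esub> (\<ominus>\<^bsub>T\<^esub> (\<ominus>\<^bsub>T\<^esub> x) \<squnion>\<^bsub>T\<^esub> \<cc>\<^bsub>T\<^esub>) =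
        (\<ominus>\<^bsub>T\<^esub> x \<squnion>\<^bsub>T\<^esub> \<ominus>\<^bsub>T\<^esub> (\<ominus>\<^bsub>T\<^esub> x)) \<squnion>\<^bsub>T\<^esub> \<cc>\<^bsub>T\<^esub>"
      using x by (simp add: join_distrib_right[symmetric] kan_closed)
    ultimately show ?case
      using x by (simp add: stone kan_closed bound_simps)
  qed (simp_all add: kan_closed join_assoc meet_assoc join_meet_absorb meet_join_absorb
      meet_join_distrib one_greatest leq_refl leq_meetI join joined)
qed

lemma C_hom:
  assumes "centered_stone_kan_algebra T" "centered_stone_kan_algebra S" "f \<in> kanc_hom T S"
  shows "(\<lambda>x \<in> carrier (C_ob T). f x) \<in> p_hom (C_ob T) (C_ob S)"
proof -
  interpret centered_stone_kan_algebra T by fact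
  interpret C: stone_algebra "C_ob T"
    using assms(1) by (rule C_ob_stone_algebra)
  note hom = bdl_homD[OF kanc_homD(1)[OF assms(3)]] kanc_homD(2-4)[OF assms(3)]
  have mono: "\<cc>\<^bsub>S\<^esub> \<sqsubseteq>\<^bsub>S\<^esub> f x" if "x \<in> carrier T" "\<cc>\<^bsub>T\<^esub> \<sqsubseteq>\<^bsub>T\<^esub> x" for x
    using that hom(3)[OF center_closed, of x] by (simp add: leq_def hom)
  show ?thesis
    using C.p_closed
    by (auto simp: p_hom_def bdl_hom_def hom mono kan_closed)
qed


section \<open>The unit and the counit\<close>

lemma C_K_ob_iff:
  assumes "stone_algebra A"
  shows "p \<in> carrier (C_ob (K_ob A)) \<longleftrightarrow> (\<exists>x \<in> carrier A. p = \<langle>x, \<zero>\<^bsub>A\<^esub>\<rangle>)"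
proof -
  interpret stone_algebra A by fact
  show ?thesis
    by (auto elim!: K_ob_cases simp: leq_def p_closed bound_simps)
qed

lemma alpha_hom:
  assumes "stone_algebra A"
  shows "(\<lambda>x \<in> carrier A. \<langle>x, \<zero>\<^bsub>A\<^esub>\<rangle>) \<in> p_hom A (C_ob (K_ob A))"
proof -
  interpret stone_algebra A by fact
  show ?thesis
    using C_K_ob_iff[OF assms]
    by (auto simp: p_hom_def bdl_hom_def p_closed bound_simps simp del: C_ob_simps(1))
qed

lemma alpha_bij:
  assumes "stone_algebra A"
  shows "bij_betw (\<lambda>x \<in> carrier A. \<langle>x, \<zero>\<^bsub>A\<^esub>\<rangle>) (carrier A) (carrier (C_ob (K_ob A)))"
  using C_K_ob_iff[OF assms]
  by (auto simp: bij_betw_def inj_on_def simp del: C_ob_simps(1))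

text \<open>
  The two components are disjoint in \<open>C(T)\<close> because \<open>x \<sqinter> \<sim> x \<sqsubseteq> c\<close>. For \<open>\<ominus>\<close>, the
  second components agree by \<open>kneg_ineg_join_center\<close> and the first by \<open>ineg_join_center\<close>.
\<close>

lemma beta_hom:
  assumes "centered_stone_kan_algebra T"
  shows "(\<lambda>x \<in> carrier T. \<langle>x \<squnion>\<^bsub>T\<^esub> \<cc>\<^bsub>T\<^esub>, \<sim>\<^bsub>T\<^esub> x \<squnion>\<^bsub>T\<^esub> \<cc>\<^bsub>T\<^esub>\<rangle>) \<in> kanc_hom T (K_ob (C_ob T))"
proof -
  interpret centered_stone_kan_algebra T by fact
  have disjoint: "(x \<squnion>\<^bsub>T\<^esub> \<cc>\<^bsub>T\<^esub>) \<sqinter>\<^bsub>T\<^esub> (\<sim>\<^bsub>T\<^esub> x \<squnion>\<^bsub>T\<^esub> \<cc>\<^bsub>T\<^esub>) = \<cc>\<^bsub>T\<^esub>" if "x \<in> carrier T" for x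
    using that meet_kneg_leq_center[of x]
    by (simp add: join_meet_distrib_right[symmetric] leq_iff_join kan_closed)
  have join_center: "\<zero>\<^bsub>T\<^esub> \<squnion>\<^bsub>T\<^esub> \<cc>\<^bsub>T\<^esub> = \<cc>\<^bsub>T\<^esub>" "\<one>\<^bsub>T\<^esub> \<squnion>\<^bsub>T\<^esub> \<cc>\<^bsub>T\<^esub> = \<one>\<^bsub>T\<^esub>" "\<cc>\<^bsub>T\<^esub> \<squnion>\<^bsub>T\<^esub> \<cc>\<^bsub>T\<^esub> = \<cc>\<^bsub>T\<^esub>"
    by (simp_all add: bound_simps join_idem center_closed)
  have pair: "\<langle>x \<squnion>\<^bsub>T\<^esub> \<cc>\<^bsub>T\<^esub>, \<sim>\<^bsub>T\<^esub> x \<squnion>\<^bsub>T\<^esub> \<cc>\<^bsub>T\<^esub>\<rangle> \<in> carrier (K_ob (C_ob T))" if "x \<in> carrier T" for x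
    using that by (simp add: disjoint leq_join2 kan_closed)
  show ?thesis
    unfolding kanc_hom_def bdl_hom_def
  proof (intro CollectI conjI ballI, goal_cases)
    case (2 x y)
    then show ?case by (simp add: kan_closed join_distrib_right[of x y "\<cc>\<^bsub>T\<^esub>"] kneg_join join_meet_distrib_right)
  next
    case (3 x y)
    then show ?case by (simp add: kan_closed join_distrib_right[of "\<sim>\<^bsub>T\<^esub> x" "\<sim>\<^bsub>T\<^esub> y" "\<cc>\<^bsub>T\<^esub>"] kneg_meet join_meet_distrib_right)
  qed (simp_all add: pair kan_closed kneg_kneg kneg_zero kneg_one kneg_center ineg_join_center
        kneg_ineg_join_center join_center del: K_ob_simps(1))
qed

text \<open>
  Equal images mean equal joins with \<open>c\<close> and, after applying \<open>\<sim>\<close> to the second components, equal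
  meets with \<open>c\<close>; cancellation gives injectivity. The witness for surjectivity can be read off
  in \<open>K(A)\<close>: there \<open>a = (u, 0)\<close> and \<open>b = (v, 0)\<close> with \<open>u\<close> disjoint from \<open>v\<close>, and
  \<open>a \<sqinter> \<ominus> b = (u \<sqinter> v\<^sup>*, v) = (u, v)\<close>.
\<close>

lemma beta_bij:
  assumes "centered_stone_kan_algebra T"
  shows "bij_betw (\<lambda>x \<in> carrier T. \<langle>x \<squnion>\<^bsub>T\<^esub> \<cc>\<^bsub>T\<^esub>, \<sim>\<^bsub>T\<^esub> x \<squnion>\<^bsub>T\<^esub> \<cc>\<^bsub>T\<^esub>\<rangle>)
    (carrier T) (carrier (K_ob (C_ob T)))" (is "bij_betw ?b _ _")
proof (rule bij_betw_imageI)
  interpret centered_stone_kan_algebra T by fact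
  show "inj_on ?b (carrier T)"
  proof (rule inj_onI)
    fix x y
    assume xy: "x \<in> carrier T" "y \<in> carrier T" and eq: "?b x = ?b y"
    then have join: "x \<squnion>\<^bsub>T\<^esub> \<cc>\<^bsub>T\<^esub> = y \<squnion>\<^bsub>T\<^esub> \<cc>\<^bsub>T\<^esub>"
      and "\<sim>\<^bsub>T\<^esub> (x \<sqinter>\<^bsub>T\<^esub> \<cc>\<^bsub>T\<^esub>) = \<sim>\<^bsub>T\<^esub> (y \<sqinter>\<^bsub>T\<^esub> \<cc>\<^bsub>T\<^esub>)"
      by (simp_all add: kneg_meet_center)
    then have "x \<sqinter>\<^bsub>T\<^esub> \<cc>\<^bsub>T\<^esub> = y \<sqinter>\<^bsub>T\<^esub> \<cc>\<^bsub>T\<^esub>"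
      using xy by (metis kneg_kneg kan_closed(2) center_closed)
    with join show "x = y"
      using xy by (intro join_meet_cancel[of x y "\<cc>\<^bsub>T\<^esub>"]) (simp_all add: kan_closed)
  qed
  have "p \<in> ?b ` carrier T" if "p \<in> carrier (K_ob (C_ob T))" for p
  proof -
    obtain a b where p: "p = \<langle>a, b\<rangle>" and a: "a \<in> carrier T" "\<cc>\<^bsub>T\<^esub> \<sqsubseteq>\<^bsub>T\<^esub> a"
      and b: "b \<in> carrier T" "\<cc>\<^bsub>T\<^esub> \<sqsubseteq>\<^bsub>T\<^esub> b" and ab: "a \<sqinter>\<^bsub>T\<^esub> b = \<cc>\<^bsub>T\<^esub>"
      using \<open>p \<in> carrier (K_ob (C_ob T))\<close> by (auto elim: K_ob_cases)
    have absorb: "a \<squnion>\<^bsub>T\<^esub> \<cc>\<^bsub>T\<^esub> = a" "b \<squnion>\<^bsub>T\<^esub> \<cc>\<^bsub>T\<^esub> = b" "a \<sqinter>\<^bsub>T\<^esub> \<cc>\<^bsub>T\<^esub> = \<cc>\<^bsub>T\<^esub>"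
      using a b leq_iff_join[of "\<cc>\<^bsub>T\<^esub>"] unfolding leq_def
      by (simp_all add: join_comm meet_comm center_closed)
    let ?x = "a \<sqinter>\<^bsub>T\<^esub> \<ominus>\<^bsub>T\<^esub> b"
    have "?x \<squnion>\<^bsub>T\<^esub> \<cc>\<^bsub>T\<^esub> = a \<sqinter>\<^bsub>T\<^esub> (\<ominus>\<^bsub>T\<^esub> b \<squnion>\<^bsub>T\<^esub> \<cc>\<^bsub>T\<^esub>)"
      using a b absorb by (simp add: join_meet_distrib_right kan_closed)
    also have "\<dots> = a"
      using a b ab disjoint_above_center_iff[of a b] by (simp add: leq_def)
    finally have 1: "?x \<squnion>\<^bsub>T\<^esub> \<cc>\<^bsub>T\<^esub> = a" .
    have "?x \<sqinter>\<^bsub>T\<^esub> \<cc>\<^bsub>T\<^esub> = \<ominus>\<^bsub>T\<^esub> b \<sqinter>\<^bsub>T\<^esub> (a \<sqinter>\<^bsub>T\<^esub> \<cc>\<^bsub>T\<^esub>)"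
      using a b by (simp add: meet_comm[of a "\<ominus>\<^bsub>T\<^esub> b"] meet_assoc kan_closed)
    also have "\<dots> = \<sim>\<^bsub>T\<^esub> b \<sqinter>\<^bsub>T\<^esub> \<cc>\<^bsub>T\<^esub>"
      using b absorb by (simp add: ineg_meet_center)
    also have "\<dots> = \<sim>\<^bsub>T\<^esub> b"
      using b absorb by (simp add: kneg_join_center[symmetric])
    finally have "\<sim>\<^bsub>T\<^esub> ?x \<squnion>\<^bsub>T\<^esub> \<cc>\<^bsub>T\<^esub> = b"
      using a b by (simp add: kneg_meet_center[symmetric] kneg_kneg kan_closed)
    with 1 have "p = ?b ?x"
      using a b p by (simp add: kan_closed)
    then show ?thesis
      using a b by (intro image_eqI[of _ _ ?x]) (simp_all add: kan_closed)
  qed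
  then show "?b ` carrier T = carrier (K_ob (C_ob T))"
    using bdl_homD(1)[OF kanc_homD(1)[OF beta_hom[OF assms]]] by blast
qed


section \<open>The equivalence\<close>

interpretation p_homs: algebraic_homs "{A. stone_algebra A}" p_hom
  by (rule p_hom_algebraic)

interpretation kanc_homs: algebraic_homs "{T. centered_stone_kan_algebra T}" kanc_hom
  by (rule kanc_hom_algebraic)

text \<open>
  Maps are restricted to carriers at every stage, so in functoriality and naturality the equations
  between maps need the intermediate values to lie in the relevant carriers; beyond that they
  follow by evaluation.
\<close>

lemma K_functor_covariant: "covariant_functor Stone SKANc K_functor"
proof -
  have compose: "(\<lambda>p \<in> carrier (K_ob A). \<langle>compose (carrier A) g h (pfst p), compose (carrier A) g h (psnd p)\<rangle>) =
      compose (carrier (K_ob A)) (\<lambda>p \<in> carrier (K_ob B). \<langle>g (pfst p), g (psnd p)\<rangle>)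
        (\<lambda>p \<in> carrier (K_ob A). \<langle>h (pfst p), h (psnd p)\<rangle>)"
    if "stone_algebra A" and h: "h \<in> p_hom A B" for A B :: "'u stone_ob" and g h :: "'u univ \<Rightarrow> 'u univ"
  proof -
    have "\<langle>h x, h y\<rangle> \<in> carrier (K_ob B)" if "\<langle>x, y\<rangle> \<in> carrier (K_ob A)" for x y
      using bdl_homD(1)[OF kanc_homD(1)[OF K_hom[OF \<open>stone_algebra A\<close> h]] that] that by simp
    then show ?thesis
      by (auto simp: compose_def elim!: K_ob_cases intro!: restrict_ext)
  qed
  have ident: "(\<lambda>p \<in> carrier (K_ob A). \<langle>(\<lambda>x \<in> carrier A. x) (pfst p), (\<lambda>x \<in> carrier A. x) (psnd p)\<rangle>) =
      (\<lambda>p \<in> carrier (K_ob A). p)" for A :: "'u stone_ob"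
    by (auto elim!: K_ob_cases intro!: restrict_ext)
  show ?thesis
    unfolding covariant_functor_def covariant_functor_axioms_def Stone_def SKANc_def
    using p_homs.concrete_category kanc_homs.concrete_category
    by (auto simp: concrete_category_def K_functor_def K_ob_centered_stone_kan_algebra K_hom ident compose
        simp del: restrict_apply restrict_restrict)
qed

lemma C_functor_covariant: "covariant_functor SKANc Stone C_functor"
proof -
  have compose: "(\<lambda>x \<in> carrier (C_ob T). compose (carrier T) g f x) =
      compose (carrier (C_ob T)) (\<lambda>x \<in> carrier (C_ob S). g x) (\<lambda>x \<in> carrier (C_ob T). f x)"
    if "centered_stone_kan_algebra T" "centered_stone_kan_algebra S" and f: "f \<in> kanc_hom T S"
    for T S :: "'u skanc_ob" and g f :: "'u univ \<Rightarrow> 'u univ"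
  proof -
    have "(\<lambda>x \<in> carrier (C_ob T). f x) x \<in> carrier (C_ob S)" if "x \<in> carrier (C_ob T)" for x
      using bdl_homD(1)[OF p_homD(1)[OF C_hom[OF \<open>centered_stone_kan_algebra T\<close>
        \<open>centered_stone_kan_algebra S\<close> f]] that] .
    then show ?thesis
      by (auto simp: compose_def intro!: restrict_ext)
  qed
  have ident: "(\<lambda>x \<in> carrier (C_ob T). (\<lambda>x \<in> carrier T. x) x) = (\<lambda>x \<in> carrier (C_ob T). x)"
    for T :: "'u skanc_ob"
    by (auto intro!: restrict_ext simp del: restrict_restrict)
  show ?thesis
    unfolding covariant_functor_def covariant_functor_axioms_def Stone_def SKANc_def
    using p_homs.concrete_category kanc_homs.concrete_category
    by (auto simp: concrete_category_def C_functor_def C_ob_stone_algebra C_hom ident compose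
        simp del: C_ob_simps(1) restrict_apply restrict_restrict)
qed

lemma alpha_natural_isomorphism:
  "natural_isomorphism Stone Stone id_functor (comp_functor C_functor K_functor) alpha"
proof -
  have natural: "compose (carrier A) (\<lambda>x \<in> carrier B. \<langle>x, \<zero>\<^bsub>B\<^esub>\<rangle>) h =
      compose (carrier A) (\<lambda>p \<in> carrier (C_ob (K_ob A)).
        (\<lambda>p \<in> carrier (K_ob A). \<langle>h (pfst p), h (psnd p)\<rangle>) p) (\<lambda>x \<in> carrier A. \<langle>x, \<zero>\<^bsub>A\<^esub>\<rangle>)"
    if "stone_algebra A" "h \<in> p_hom A B" for A B :: "'u stone_ob" and h
  proof -
    have "\<langle>x, \<zero>\<^bsub>A\<^esub>\<rangle> \<in> carrier (C_ob (K_ob A))" "\<langle>x, \<zero>\<^bsub>A\<^esub>\<rangle> \<in> carrier (K_ob A)"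
      if "x \<in> carrier A" for x
      using C_K_ob_iff[OF \<open>stone_algebra A\<close>, of "\<langle>x, \<zero>\<^bsub>A\<^esub>\<rangle>"] that by auto
    then show ?thesis
      using bdl_homD[OF p_homD(1)[OF that(2)]]
      by (auto simp: compose_def intro!: restrict_ext simp del: C_ob_simps(1) K_ob_simps(1))
  qed
  have iso: "isomorphism Stone (alpha A)" if "stone_algebra A" for A :: "'u stone_ob"
    unfolding Stone_def alpha_def using that
    by (intro p_homs.isomorphism_if_bij_betw)
      (simp_all add: K_ob_centered_stone_kan_algebra C_ob_stone_algebra alpha_hom alpha_bij
        del: bij_betw_restrict_eq)
  have cat: "category Stone"
    unfolding Stone_def by (rule p_homs.concrete_category)
  show ?thesis
    unfolding natural_isomorphism_def natural_transformation_def
      natural_transformation_axioms_def natural_isomorphism_axioms_def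
    using covariant_functor_id[OF cat] covariant_functor_comp[OF K_functor_covariant C_functor_covariant]
      iso
    by (auto simp: Stone_def concrete_category_def id_functor_def comp_functor_def C_functor_def
        K_functor_def alpha_def K_ob_centered_stone_kan_algebra C_ob_stone_algebra alpha_hom natural
        simp del: restrict_apply restrict_restrict)
qed

lemma beta_natural_isomorphism:
  "natural_isomorphism SKANc SKANc id_functor (comp_functor K_functor C_functor) beta"
proof -
  have natural: "compose (carrier T) (\<lambda>x \<in> carrier S. \<langle>x \<squnion>\<^bsub>S\<^esub> \<cc>\<^bsub>S\<^esub>, \<sim>\<^bsub>S\<^esub> x \<squnion>\<^bsub>S\<^esub> \<cc>\<^bsub>S\<^esub>\<rangle>) f =
      compose (carrier T) (\<lambda>p \<in> carrier (K_ob (C_ob T)).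
        \<langle>(\<lambda>x \<in> carrier (C_ob T). f x) (pfst p), (\<lambda>x \<in> carrier (C_ob T). f x) (psnd p)\<rangle>)
        (\<lambda>x \<in> carrier T. \<langle>x \<squnion>\<^bsub>T\<^esub> \<cc>\<^bsub>T\<^esub>, \<sim>\<^bsub>T\<^esub> x \<squnion>\<^bsub>T\<^esub> \<cc>\<^bsub>T\<^esub>\<rangle>)"
    if T: "centered_stone_kan_algebra T" and f: "f \<in> kanc_hom T S" for T S :: "'u skanc_ob" and f
  proof -
    interpret centered_stone_kan_algebra T by fact
    note hom = bdl_homD[OF kanc_homD(1)[OF f]] kanc_homD(2-4)[OF f]
    have "\<langle>x \<squnion>\<^bsub>T\<^esub> \<cc>\<^bsub>T\<^esub>, \<sim>\<^bsub>T\<^esub> x \<squnion>\<^bsub>T\<^esub> \<cc>\<^bsub>T\<^esub>\<rangle> \<in> carrier (K_ob (C_ob T))" if "x \<in> carrier T" for x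
      using bdl_homD(1)[OF kanc_homD(1)[OF beta_hom[OF T]] that] that by simp
    then show ?thesis
      by (auto simp: compose_def hom kan_closed intro!: restrict_ext)
  qed
  have iso: "isomorphism SKANc (beta T)" if "centered_stone_kan_algebra T" for T :: "'u skanc_ob"
    unfolding SKANc_def beta_def using that
    by (intro kanc_homs.isomorphism_if_bij_betw)
      (simp_all add: K_ob_centered_stone_kan_algebra C_ob_stone_algebra beta_hom beta_bij
        del: bij_betw_restrict_eq)
  have cat: "category SKANc"
    unfolding SKANc_def by (rule kanc_homs.concrete_category)
  show ?thesis
    unfolding natural_isomorphism_def natural_transformation_def
      natural_transformation_axioms_def natural_isomorphism_axioms_def
    using covariant_functor_id[OF cat] covariant_functor_comp[OF C_functor_covariant K_functor_covariant]
      iso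
    by (auto simp: SKANc_def concrete_category_def id_functor_def comp_functor_def C_functor_def
        K_functor_def beta_def K_ob_centered_stone_kan_algebra C_ob_stone_algebra beta_hom natural
        simp del: restrict_apply restrict_restrict)
qed

theorem theorem3p6:
  "categorical_equivalence (Stone :: ('u stone_ob, ('u stone_ob, 'u univ) arrow) precategory)
     SKANc K_functor C_functor alpha beta"
  unfolding categorical_equivalence_def
  by (intro conjI K_functor_covariant C_functor_covariant alpha_natural_isomorphism
      beta_natural_isomorphism)

end
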